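(* Let $d\ge1$, $2<q<\infty$, and let $\widetilde B$ be the unit ball of $\mathbb R^{2d}$ centered at the origin. Then the operator $(f_1,f_2)\mapsto V_q(\mathbf A_t^{\widetilde B}(f_1,f_2):t>0)$ is not of restricted weak type $(\infty,\infty,\infty)$: there is no constant $C$ such that $$\|V_q(\mathbf A_t^{\widetilde B}(\mathbf 1_E,\mathbf 1_F):t>0)\|_{L^\infty(\mathbb R^d)}\le C$$ for all measurable sets $E,F\subset\mathbb R^d$ of finite measure.
   Context: For $t>0$, $\widetilde B_t=\{z\in\mathbb R^{2d}:t^{-1}z\in\widetilde B\}$ and $\mathbf A_t^{\widetilde B}(f_1,f_2)(x)=\frac1{|\widetilde B_t|}\int_{\widetilde B_t}f_1(x+y_1)f_2(x+y_2)\,dy_1dy_2$ for $x\in\mathbb R^d$. For a family $(a_t)_{t>0}$, $V_q(a_t(x):t>0)=\sup\big(\sum_{k\ge0}|a_{t_{k+1}}(x)-a_{t_k}(x)|^q\big)^{1/q}$, the supremum over all increasing sequences $(t_k)_{k\ge0}$ of positive numbers. *)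

theory Defs
  imports "HOL-Analysis.Analysis" "HOL-Probability.Essential_Supremum"
begin

definition dilate :: "real \<Rightarrow> 'b::real_vector set \<Rightarrow> 'b set" where
  "dilate t B = {z. inverse t *\<^sub>R z \<in> B}"

text \<open>The product type carries the Euclidean norm \<open>sqrt ((norm y1)\<^sup>2 + (norm y2)\<^sup>2)\<close>, so for
  \<open>'a\<close> of dimension \<open>d\<close> the type \<open>'a \<times> 'a\<close> is the Euclidean space of dimension \<open>2 * d\<close>.\<close>

definition bilinear_avg ::
    "('a::euclidean_space \<times> 'a) set \<Rightarrow> real \<Rightarrow> ('a \<Rightarrow> real) \<Rightarrow> ('a \<Rightarrow> real) \<Rightarrow> 'a \<Rightarrow> real" where
  "bilinear_avg B t f1 f2 x =
     1 / measure lebesgue (dilate t B) *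
       (LINT y:dilate t B|lebesgue. f1 (x + fst y) * f2 (x + snd y))"

text \<open>Powers with exponent \<open>p > 0\<close> on \<open>[0, \<infinity>]\<close>.\<close>

definition ennreal_powr :: "ennreal \<Rightarrow> real \<Rightarrow> ennreal" where
  "ennreal_powr x p = (if x = \<infinity> then \<infinity> else ennreal (enn2real x powr p))"

definition variation :: "real \<Rightarrow> (real \<Rightarrow> real) \<Rightarrow> ennreal" where
  "variation q a =
     (SUP t \<in> {t :: nat \<Rightarrow> real. strict_mono t \<and> (\<forall>k. t k > 0)}.
        ennreal_powr (\<Sum>k. ennreal (\<bar>a (t (Suc k)) - a (t k)\<bar> powr q)) (1 / q))"

text \<open>The \<open>L\<^sup>\<infinity>\<close> norm of a nonnegative function. The constant \<^const>\<open>esssup\<close> is \<open>\<infinity>\<close> by convention on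
  non-measurable functions; this version is not, and agrees with it on measurable ones.\<close>

definition Linf_norm :: "('a::euclidean_space \<Rightarrow> ennreal) \<Rightarrow> ennreal" where
  "Linf_norm g = Inf {c. AE x in lebesgue. g x \<le> c}"

lemma Linf_norm_eq_esssup:
  "g \<in> borel_measurable lebesgue \<Longrightarrow> Linf_norm g = esssup lebesgue g"
  by (simp add: Linf_norm_def esssup_eq_AE)

text \<open>Restricted weak type \<open>(\<infinity>, \<infinity>, \<infinity>)\<close>; the class \<^const>\<open>lmeasurable\<close> consists of the Lebesgue
  measurable sets of finite measure.\<close>

definition restricted_weak_type_infty ::
    "(('a::euclidean_space \<Rightarrow> real) \<Rightarrow> ('a \<Rightarrow> real) \<Rightarrow> 'a \<Rightarrow> ennreal) \<Rightarrow> bool" where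
  "restricted_weak_type_infty T \<longleftrightarrow>
     (\<exists>C::real. \<forall>E \<in> lmeasurable. \<forall>F \<in> lmeasurable.
        Linf_norm (T (indicator E) (indicator F)) \<le> ennreal C)"

end

theory Submission
  imports Defs
begin

text \<open>Take \<open>F\<close> to be a huge ball, so that for the relevant \<open>x\<close> and \<open>t\<close> the second factor is
  identically \<open>1\<close>, and let \<open>E\<close> consist of every other annulus between the spheres of radius
  \<open>64^k\<close>. At the radius \<open>t = 64^(k+1) - 1\<close> and for \<open>\<bar>x\<bar> < 1\<close>, up to the small part where
  \<open>\<bar>y1\<bar> < 64^k + 1\<close>, the point \<open>x + y1\<close> lies in the \<open>k\<close>-th annulus; hence the averages alternate
  between values \<open>\<ge> 3/4\<close> and \<open>\<le> 1/4\<close> as often as desired.\<close>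

text \<open>The product formula is known for \<open>lborel\<close>; on Borel sets the completed
  measure takes the same values.\<close>

lemma measure_lebesgue_Times:
  fixes A :: "'a::euclidean_space set" and B :: "'b::euclidean_space set"
  assumes "A \<in> sets borel" "B \<in> sets borel"
  shows "measure lebesgue (A \<times> B) = measure lebesgue A * measure lebesgue B"
proof -
  have "A \<times> B \<in> sets (lborel :: ('a \<times> 'b) measure)"
    unfolding lborel_prod [symmetric] using assms by simp
  moreover have "emeasure (lborel :: ('a \<times> 'b) measure) (A \<times> B)
      = emeasure lborel A * emeasure lborel B"
    unfolding lborel_prod [symmetric] using assms by (intro lborel.emeasure_pair_measure_Times) auto
  ultimately show ?thesis
    using assms by (simp add: measure_completion measure_def enn2real_mult)
qed

lemma measure_lebesgue_ball:
  fixes c :: "'a::euclidean_space"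
  assumes "r \<ge> 0"
  shows "measure lebesgue (ball c r) = unit_ball_vol DIM('a) * r ^ DIM('a)"
  using content_ball [OF assms, of c] by (simp add: measure_completion)

lemma dilate_ball:
  fixes t :: real
  assumes "t > 0"
  shows "dilate t (ball (0::'b::real_normed_vector) 1) = ball 0 t"
  using assms by (auto simp: dilate_def field_simps)

text \<open>The slab lies in a product of balls of radii \<open>s\<close> and \<open>t\<close>, and
  \<open>s * t \<le> (1/4) * (t/2)\<^sup>2\<close>. Comparing with the product of two balls of
  radius \<open>t/2\<close>, which fits inside the ball of radius \<open>t\<close>, avoids computing
  the volume of the \<open>2 * d\<close>-dimensional ball.\<close>

lemma measure_slab_le:
  fixes t s :: real
  assumes "0 \<le> s" "16 * s \<le> t" "0 < t"
  shows "measure lebesgue {y \<in> ball (0::'a::euclidean_space \<times> 'a) t. norm (fst y) < s}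
          \<le> measure lebesgue (ball (0::'a \<times> 'a) t) / 4"
proof -
  let ?d = "DIM('a)" and ?v = "unit_ball_vol DIM('a)"
  have "{y \<in> ball (0::'a \<times> 'a) t. norm (fst y) < s} \<subseteq> ball 0 s \<times> ball 0 t"
    using norm_snd_le by (fastforce intro: le_less_trans)
  then have "measure lebesgue {y \<in> ball (0::'a \<times> 'a) t. norm (fst y) < s}
      \<le> measure lebesgue (ball (0::'a) s \<times> ball (0::'a) t)"
    by (intro measure_mono_fmeasurable)
       (auto intro!: bounded_set_imp_lmeasurable bounded_Times borel_open open_Times
          open_Int open_Collect_less continuous_intros sets_completionI_sets simp: Collect_conj_eq)
  also have "\<dots> = ?v\<^sup>2 * (s * t) ^ ?d"
    using assms by (simp add: measure_lebesgue_Times content_ball power2_eq_square power_mult_distrib)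
  also have "\<dots> \<le> ?v\<^sup>2 * ((t/2)^?d * (t/2)^?d / 4)"
  proof (rule mult_left_mono)
    have "(s * t) ^ ?d \<le> ((1/4) * ((t/2) * (t/2))) ^ ?d"
      using assms by (intro power_mono) (auto intro: mult_right_mono)
    also have "\<dots> = (1/4)^?d * ((t/2)^?d * (t/2)^?d)"
      by (simp only: power_mult_distrib)
    \<comment> \<open>Here \<open>?d \<ge> 1\<close> enters.\<close>
    also have "\<dots> \<le> (1/4) * ((t/2)^?d * (t/2)^?d)"
      using assms power_decreasing [of 1 ?d "1/4::real"]
      by (intro mult_right_mono) (auto simp: Suc_leI)
    finally show "(s * t) ^ ?d \<le> (t/2)^?d * (t/2)^?d / 4" by simp
  qed simp
  also have "\<dots> = measure lebesgue (ball (0::'a) (t/2) \<times> ball (0::'a) (t/2)) / 4"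
    using assms by (simp add: measure_lebesgue_Times content_ball power2_eq_square)
  also have "\<dots> \<le> measure lebesgue (ball (0::'a \<times> 'a) t) / 4"
  proof -
    have "ball (0::'a) (t/2) \<times> ball (0::'a) (t/2) \<subseteq> ball 0 t"
    proof clarsimp
      fix a b :: 'a
      assume "norm a * 2 < t" "norm b * 2 < t"
      then show "norm (a, b) < t"
        using norm_Pair_le [of a b] by linarith
    qed
    then show ?thesis
      by (intro divide_right_mono measure_mono_fmeasurable)
         (auto intro!: sets_completionI_sets borel_open open_Times)
  qed
  finally show ?thesis .
qed

lemma bilinear_avg_indicator:
  fixes x :: "'a::euclidean_space"
  assumes "t > 0"
  shows "bilinear_avg (ball 0 1) t (indicator E) (indicator F) x
    = measure lebesgue {y \<in> ball 0 t. x + fst y \<in> E \<and> x + snd y \<in> F}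
        / measure lebesgue (ball (0::'a \<times> 'a) t)"
proof -
  have "(\<lambda>y. indicator (ball (0::'a \<times> 'a) t) y *\<^sub>R
          (indicator E (x + fst y) * indicator F (x + snd y) :: real))
      = indicator {y \<in> ball 0 t. x + fst y \<in> E \<and> x + snd y \<in> F}"
    by (auto simp: indicator_def)
  then show ?thesis
    using assms by (simp add: bilinear_avg_def dilate_ball set_lebesgue_integral_def)
qed

definition annulus :: "nat \<Rightarrow> 'a::euclidean_space set" where
  "annulus k = ball 0 (64 ^ Suc k) - ball 0 (64 ^ k)"

text \<open>The union is finite so that the set has finite measure; its outermost annulus has index
  \<open>2 * N\<close>.\<close>

definition even_annuli :: "nat \<Rightarrow> 'a::euclidean_space set" where
  "even_annuli N = (\<Union>j\<le>N. annulus (2 * j))"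

lemma annulus_index_unique:
  assumes "z \<in> annulus j" "z \<in> annulus k"
  shows "j = k"
proof -
  have "(64::real) ^ j < 64 ^ Suc k" "(64::real) ^ k < 64 ^ Suc j"
    using assms unfolding annulus_def mem_ball_0 Diff_iff by linarith+
  then have "j < Suc k" "k < Suc j"
    by (auto dest!: power_less_imp_less_exp [rotated] simp del: power_Suc)
  then show ?thesis by simp
qed

lemma even_annuli_borel: "even_annuli N \<in> sets borel"
  by (auto simp: even_annuli_def annulus_def)

lemma even_annuli_lmeasurable: "even_annuli N \<in> lmeasurable"
  unfolding even_annuli_def annulus_def
  by (intro fmeasurable.finite_UN fmeasurable.Diff) auto

lemma bilinear_avg_even_annuli:
  fixes x :: "'a::euclidean_space"
  assumes x: "norm x < 1" and M: "64 ^ Suc k \<le> M" and k: "k \<le> 2 * N"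
  defines "a \<equiv> bilinear_avg (ball 0 1) (64 ^ Suc k - 1) (indicator (even_annuli N)) (indicator (ball 0 M)) x"
  shows "if even k then a \<ge> 3/4 else a \<le> 1/4"
proof -
  define t :: real where "t = 64 ^ Suc k - 1"
  define s :: real where "s = 64 ^ k + 1"
  \<comment> \<open>Applied to \<open>X = 64 ^ k\<close>, this is where the ratio 64 is used: it
    leaves room for the factor 16 of \<open>measure_slab_le\<close>.\<close>
  have "64 * X - 1 > 0 \<and> X + 1 \<ge> 0 \<and> 16 * (X + 1) \<le> 64 * X - 1" if "1 \<le> X" for X :: real
    using that by auto
  from this [of "64 ^ k"] have t: "t > 0" and s: "s \<ge> 0" "16 * s \<le> t"
    by (simp_all add: t_def s_def)
  let ?B = "ball (0::'a \<times> 'a) t"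
  let ?G = "{y \<in> ?B. x + fst y \<in> even_annuli N \<and> x + snd y \<in> ball 0 M}"
  let ?S = "{y \<in> ?B. norm (fst y) < s}"
  have a: "a = measure lebesgue ?G / measure lebesgue ?B"
    using bilinear_avg_indicator [OF t, of "even_annuli N" "ball 0 M" x] by (simp only: a_def t_def)
  have pos: "measure lebesgue ?B > 0"
    using t by (simp add: measure_lebesgue_ball)
  have S: "measure lebesgue ?S \<le> measure lebesgue ?B / 4"
    by (rule measure_slab_le [OF s t])
  have "?G = ?B \<inter> (\<lambda>y. x + fst y) -` even_annuli N \<inter> (\<lambda>y. x + snd y) -` ball 0 M"
    "?S = ?B \<inter> fst -` ball 0 s"
    by auto
  then have "?G \<in> sets borel" "?S \<in> sets borel"
    by (auto intro!: sets.Int measurable_sets_borel [of _ borel] even_annuli_borel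
        borel_measurable_continuous_onI continuous_intros simp del: mem_ball)
  then have meas: "?G \<in> lmeasurable" "?S \<in> lmeasurable"
    by (auto intro!: bounded_set_imp_lmeasurable intro: bounded_subset [OF bounded_ball [of 0 t]])
  \<comment> \<open>The shifts by 1 in \<open>s\<close> and \<open>t\<close> absorb the translation
    by \<open>x\<close>, as \<open>norm x < 1\<close>. Also
    \<open>norm (x + snd y) < t + 1 \<le> M\<close>, so the second factor is 1 on the whole
    ball.\<close>
  have in_annulus: "x + fst y \<in> annulus k" "x + snd y \<in> ball 0 M"
    if "y \<in> ?B" "norm (fst y) \<ge> s" for y
  proof -
    have "norm (fst y) < t" "norm (snd y) < t"
      using that norm_fst_le [of "fst y" "snd y"] norm_snd_le [of "snd y" "fst y"] by auto
    moreover have "norm (fst y) \<le> norm (x + fst y) + norm x"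
      using norm_triangle_ineq4 [of "x + fst y" x] by simp
    ultimately show "x + fst y \<in> annulus k" "x + snd y \<in> ball 0 M"
      using that x M norm_triangle_ineq [of x "fst y"] norm_triangle_ineq [of x "snd y"]
      by (auto simp: annulus_def t_def s_def)
  qed
  show ?thesis
  proof (cases "even k")
    case True
    then have "annulus k \<subseteq> (even_annuli N :: 'a set)"
      using k by (auto simp: even_annuli_def elim!: evenE)
    \<comment> \<open>Off the slab both indicators equal 1, so \<open>?G\<close> misses at most a
      quarter of the ball.\<close>
    then have "?B \<subseteq> ?G \<union> ?S"
      using in_annulus by fastforce
    then have "measure lebesgue ?B \<le> measure lebesgue (?G \<union> ?S)"
      using meas by (intro measure_mono_fmeasurable) auto
    also have "\<dots> \<le> measure lebesgue ?G + measure lebesgue ?S"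
      using meas by (intro measure_Un_le) auto
    finally have "3/4 * measure lebesgue ?B \<le> measure lebesgue ?G"
      using S by simp
    then show ?thesis
      using True pos by (simp add: a field_simps)
  next
    case False
    have "z \<notin> even_annuli N" if "z \<in> annulus k" for z :: 'a
      using that False annulus_index_unique by (force simp: even_annuli_def)
    \<comment> \<open>Off the slab \<open>x + fst y\<close> lies in an odd annulus, disjoint from
      \<open>even_annuli N\<close>.\<close>
    then have "?G \<subseteq> ?S"
      using in_annulus by fastforce
    then have "measure lebesgue ?G \<le> measure lebesgue ?S"
      using meas by (intro measure_mono_fmeasurable) auto
    then show ?thesis
      using False pos S by (simp add: a field_simps)
  qed
qed

lemma ennreal_powr_mono:
  assumes "x \<le> y" "p \<ge> 0"
  shows "ennreal_powr x p \<le> ennreal_powr y p"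
proof (cases "y = \<infinity>")
  case False
  then have "x \<noteq> \<infinity>" using assms by (auto simp: top_unique)
  with False assms show ?thesis
    by (auto simp: ennreal_powr_def less_top intro!: ennreal_leI powr_mono2 enn2real_mono)
qed (simp add: ennreal_powr_def)

text \<open>Keeping only the first \<open>n\<close> terms of the series gives a bound that, for
  fixed \<open>\<epsilon> > 0\<close>, grows without limit in \<open>n\<close>.\<close>

lemma variation_ge:
  fixes t :: "nat \<Rightarrow> real"
  assumes "q > 0" "strict_mono t" "\<And>k. t k > 0" "\<epsilon> \<ge> 0"
    and jump: "\<And>k. k < n \<Longrightarrow> \<epsilon> \<le> \<bar>a (t (Suc k)) - a (t k)\<bar>"
  shows "ennreal (real n powr (1/q) * \<epsilon>) \<le> variation q a"
proof -
  have "ennreal (real n * \<epsilon> powr q) = (\<Sum>k<n. ennreal (\<epsilon> powr q))"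
    by (simp add: ennreal_mult ennreal_of_nat_eq_real_of_nat)
  also have "\<dots> \<le> (\<Sum>k<n. ennreal (\<bar>a (t (Suc k)) - a (t k)\<bar> powr q))"
    using assms by (intro sum_mono ennreal_leI powr_mono2) auto
  also have "\<dots> \<le> (\<Sum>k. ennreal (\<bar>a (t (Suc k)) - a (t k)\<bar> powr q))"
    by (intro sum_le_suminf) auto
  finally have "ennreal_powr (ennreal (real n * \<epsilon> powr q)) (1/q)
      \<le> ennreal_powr (\<Sum>k. ennreal (\<bar>a (t (Suc k)) - a (t k)\<bar> powr q)) (1/q)"
    using assms by (intro ennreal_powr_mono) auto
  also have "\<dots> \<le> variation q a"
    unfolding variation_def using assms by (intro SUP_upper) auto
  finally show ?thesis
    using assms by (simp add: ennreal_powr_def powr_mult powr_powr)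
qed

text \<open>An essential bound not above \<open>L\<close> would make the ball a null set, yet it is
  open and nonempty.\<close>

lemma Linf_norm_ge:
  fixes g :: "'a::euclidean_space \<Rightarrow> ennreal"
  assumes "r > 0" "\<And>x. x \<in> ball c r \<Longrightarrow> L \<le> g x"
  shows "L \<le> Linf_norm g"
  unfolding Linf_norm_def
proof (rule Inf_greatest, clarify)
  fix b assume AE: "AE x in lebesgue. g x \<le> b"
  show "L \<le> b"
  proof (rule ccontr)
    assume "\<not> L \<le> b"
    then have "AE x in lebesgue. x \<notin> ball c r"
      using AE assms(2) by (auto elim!: eventually_mono dest: order_trans)
    then have "ball c r \<in> null_sets lebesgue"
      by (simp add: AE_iff_null_sets)
    then show False
      using assms(1) open_not_negligible [of "ball c r"]
      by (auto simp: negligible_iff_null_sets)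
  qed
qed

theorem mainTheorem3:
  fixes q :: real and B :: "((real ^ 'd) \<times> (real ^ 'd)) set"
  assumes "2 < q"
    and "B = ball 0 1"
  shows "\<not> restricted_weak_type_infty
           (\<lambda>f1 f2 x. variation q (\<lambda>t. bilinear_avg B t f1 f2 x))"
proof
  let ?T = "\<lambda>f1 f2 x. variation q (\<lambda>t. bilinear_avg B t f1 f2 x)"
  assume "restricted_weak_type_infty ?T"
  then obtain C where C: "\<And>E F. E \<in> lmeasurable \<Longrightarrow> F \<in> lmeasurable \<Longrightarrow>
      Linf_norm (?T (indicator E) (indicator F)) \<le> ennreal C"
    by (auto simp: restricted_weak_type_infty_def)
  \<comment> \<open>Chosen so that \<open>2 * N\<close> jumps of size 1/2 give variation at least
    \<open>\<bar>C\<bar> + 1\<close>. The absolute value covers negative \<open>C\<close>, for which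
    \<open>ennreal C = 0\<close>.\<close>
  define N where "N = nat \<lceil>(2 * \<bar>C\<bar> + 2) powr q\<rceil>"
  let ?E = "even_annuli N :: (real ^ 'd) set"
  let ?F = "ball 0 (64 ^ Suc (2 * N)) :: (real ^ 'd) set"
  let ?t = "\<lambda>k. 64 ^ Suc k - 1 :: real"
  have "2 * \<bar>C\<bar> + 2 = ((2 * \<bar>C\<bar> + 2) powr q) powr (1/q)"
    using assms by (simp add: powr_powr)
  also have "\<dots> \<le> real (2 * N) powr (1/q)"
  proof (rule powr_mono2)
    show "(2 * \<bar>C\<bar> + 2) powr q \<le> real (2 * N)"
      using real_nat_ceiling_ge [of "(2 * \<bar>C\<bar> + 2) powr q", folded N_def] by simp
  qed (use assms in auto)
  finally have "\<bar>C\<bar> < real (2 * N) powr (1/q) * (1/2)" by simp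
  then have large: "ennreal C < ennreal (real (2 * N) powr (1/q) * (1/2))"
    by (intro ennreal_lessI) linarith+
  have "ennreal (real (2 * N) powr (1/q) * (1/2)) \<le> ?T (indicator ?E) (indicator ?F) x"
    if x: "x \<in> ball 0 1" for x
  proof (rule variation_ge [where t = ?t])
    show "strict_mono ?t" by (simp add: strict_mono_Suc_iff)
    show "?t k > 0" for k
      using one_less_power [of "64::real" "Suc k"] by simp
    \<comment> \<open>One of \<open>k\<close> and \<open>Suc k\<close> is even and the other odd, so
      the averages differ by at least 3/4 - 1/4. Both indices are at most \<open>2 * N\<close>,
      which the radius of \<open>?F\<close> accommodates.\<close>
    show "1/2 \<le> \<bar>bilinear_avg B (?t (Suc k)) (indicator ?E) (indicator ?F) x
                 - bilinear_avg B (?t k) (indicator ?E) (indicator ?F) x\<bar>" if "k < 2 * N" for k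
    proof -
      have "(64::real) ^ Suc k \<le> 64 ^ Suc (2 * N)" "(64::real) ^ Suc (Suc k) \<le> 64 ^ Suc (2 * N)"
        using that by (intro power_increasing; simp)+
      then show ?thesis
        using that x assms(2) bilinear_avg_even_annuli [of x k "64 ^ Suc (2 * N)" N]
          bilinear_avg_even_annuli [of x "Suc k" "64 ^ Suc (2 * N)" N]
        by (auto split: if_splits simp del: power_Suc)
    qed
  qed (use assms in auto)
  then have "ennreal (real (2 * N) powr (1/q) * (1/2)) \<le> Linf_norm (?T (indicator ?E) (indicator ?F))"
    by (intro Linf_norm_ge [of 1 0]) auto
  also have "\<dots> \<le> ennreal C"
    by (intro C even_annuli_lmeasurable) auto
  finally show False using large by simp
qed

end
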